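(* Let $z$ be a real quadratic irrational with expansions $z=\lfloor a_0,a_1,\ldots,a_q,\overline{b_1,\ldots,b_l}\rfloor=\lceil c_0,c_1,\ldots,c_r,\overline{d_1,\ldots,d_m}\rceil$, where $l,m$ are smallest possible and, for these, $q,r$ are smallest possible ($q=-1$, resp. $r=-1$, in the purely periodic case). Let $L=l$ if $l$ is even and $L=2l$ if $l$ is odd, with $b_{l+j}=b_j$, and assume $B:=(-1)^q\sum_{j=1}^L(-1)^{j-1}b_j=0$ (equivalently, $\frac1m\sum_{j=1}^m d_j=3$). Put $A=\sum_{k=0}^q(-1)^{k-1}a_k$ and $C=\sum_{j=0}^r(3-c_j)$ (both $0$ in the purely periodic case). For $h=1,\ldots,L$ let $u_h=\lfloor\overline{b_h,b_{h-1},\ldots,b_1,b_L,b_{L-1},\ldots,b_{h+1}}\rfloor$ and $$U_h=A+(-1)^q\sum_{k=1}^h(-1)^{k-1}b_k+\begin{cases} z+1/u_h-3 & \text{if } q+h \text{ is odd},\\ z-1/u_h & \text{if } q+h\text{ is even}.\end{cases}$$ For $i=1,\ldots,m$ let $v_i=\lceil\overline{d_i,d_{i-1},\ldots,d_1,d_m,d_{m-1},\ldots,d_{i+1}}\rceil$ and $$V_i=C+\sum_{j=1}^i(3-d_j)+z-1/v_i-3.$$ Then the numbers $U_1,\ldots,U_L$ are pairwise distinct, and the numbers $V_1,\ldots,V_m$ are pairwise distinct.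
   Context: The regular continued fraction expansion $\lfloor a_0,a_1,\ldots\rfloor$ means $a_0+1/(a_1+1/(a_2+\cdots))$, obtained by $z_0=z$, $a_0=\lfloor z_0\rfloor$, $z_{j+1}=1/(z_j-a_j)$, $a_{j+1}=\lfloor z_{j+1}\rfloor$; an overline denotes a repeating period. The negative regular expansion $\lceil c_0,c_1,\ldots\rceil$ means $c_0-1/(c_1-1/(c_2-\cdots))$, obtained by $z_0=z$, $c_0=\lceil z_0\rceil$, $z_{j+1}=1/(c_j-z_j)$, $c_{j+1}=\lceil z_{j+1}\rceil$. (In the paper, the $U_h$ are the cluster points of the Dedekind sums $S(p_k,q_k)$ of the regular convergents and the $V_i$ those of $S(s_j,t_j)$ of the negative regular convergents, when $B=0$.) *)

theory Defs
  imports Complex_Main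
begin

definition quadratic_irrational :: "real \<Rightarrow> bool" where
  "quadratic_irrational z \<longleftrightarrow> z \<notin> \<rat> \<and>
     (\<exists>\<alpha> \<beta> \<gamma> :: int. \<alpha> \<noteq> 0 \<and> of_int \<alpha> * z\<^sup>2 + of_int \<beta> * z + of_int \<gamma> = 0)"

fun reg_quot :: "real \<Rightarrow> nat \<Rightarrow> real" where
  "reg_quot z 0 = z"
| "reg_quot z (Suc j) = 1 / (reg_quot z j - of_int \<lfloor>reg_quot z j\<rfloor>)"

definition reg_digit :: "real \<Rightarrow> nat \<Rightarrow> int" where
  "reg_digit z j = \<lfloor>reg_quot z j\<rfloor>"

fun neg_quot :: "real \<Rightarrow> nat \<Rightarrow> real" where
  "neg_quot z 0 = z"
| "neg_quot z (Suc j) = 1 / (of_int \<lceil>neg_quot z j\<rceil> - neg_quot z j)"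

definition neg_digit :: "real \<Rightarrow> nat \<Rightarrow> int" where
  "neg_digit z j = \<lceil>neg_quot z j\<rceil>"

fun reg_conv :: "(nat \<Rightarrow> int) \<Rightarrow> nat \<Rightarrow> real" where
  "reg_conv s 0 = of_int (s 0)"
| "reg_conv s (Suc n) = of_int (s 0) + 1 / reg_conv (\<lambda>k. s (Suc k)) n"

definition reg_value :: "(nat \<Rightarrow> int) \<Rightarrow> real" where
  "reg_value s = lim (reg_conv s)"

fun neg_conv :: "(nat \<Rightarrow> int) \<Rightarrow> nat \<Rightarrow> real" where
  "neg_conv s 0 = of_int (s 0)"
| "neg_conv s (Suc n) = of_int (s 0) - 1 / neg_conv (\<lambda>k. s (Suc k)) n"

definition neg_value :: "(nat \<Rightarrow> int) \<Rightarrow> real" where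
  "neg_value s = lim (neg_conv s)"

(* The sequence x 0, ..., x (p - 1) followed by the block y 1, ..., y l repeated forever.
   The preperiod is measured by its length p: a preperiod with indices 0, ..., q has
   p = q + 1, and p = 0 (q = -1) is the purely periodic case. *)
definition preperiodic :: "nat \<Rightarrow> (nat \<Rightarrow> int) \<Rightarrow> nat \<Rightarrow> (nat \<Rightarrow> int) \<Rightarrow> nat \<Rightarrow> int" where
  "preperiodic p x l y k = (if k < p then x k else y ((k - p) mod l + 1))"

definition periodic :: "nat \<Rightarrow> (nat \<Rightarrow> int) \<Rightarrow> nat \<Rightarrow> int" where
  "periodic l y k = y (k mod l + 1)"

definition has_period ::
  "(nat \<Rightarrow> int) \<Rightarrow> nat \<Rightarrow> (nat \<Rightarrow> int) \<Rightarrow> nat \<Rightarrow> (nat \<Rightarrow> int) \<Rightarrow> bool" where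
  "has_period s p x l y \<longleftrightarrow> l > 0 \<and> (\<forall>k. s k = preperiodic p x l y k)"

definition has_minimal_period ::
  "(nat \<Rightarrow> int) \<Rightarrow> nat \<Rightarrow> (nat \<Rightarrow> int) \<Rightarrow> nat \<Rightarrow> (nat \<Rightarrow> int) \<Rightarrow> bool" where
  "has_minimal_period s p x l y \<longleftrightarrow> has_period s p x l y \<and>
     (\<forall>p' x' l' y'. has_period s p' x' l' y' \<longrightarrow> l \<le> l') \<and>
     (\<forall>p' x' y'. has_period s p' x' l y' \<longrightarrow> p \<le> p')"

(* For 1 \<le> h \<le> n, the entries with indices 1, ..., n are
   y h, y (h - 1), ..., y 1, y n, y (n - 1), ..., y (h + 1). *)
definition reversed_block :: "nat \<Rightarrow> (nat \<Rightarrow> int) \<Rightarrow> nat \<Rightarrow> nat \<Rightarrow> int" where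
  "reversed_block n y h i = (if i \<le> h then y (h + 1 - i) else y (n + h + 1 - i))"

(* In terms of q = p - 1, the sign (-1)^q is (-1)^(p + 1), and q + h is odd iff p + h is even. *)

definition B_sum :: "nat \<Rightarrow> nat \<Rightarrow> (nat \<Rightarrow> int) \<Rightarrow> int" where
  "B_sum p L b = (-1) ^ (p + 1) * (\<Sum>j = 1..L. (-1) ^ (j - 1) * b j)"

definition A_sum :: "nat \<Rightarrow> (nat \<Rightarrow> int) \<Rightarrow> int" where
  "A_sum p a = (\<Sum>k<p. (-1) ^ (k + 1) * a k)"

definition C_sum :: "nat \<Rightarrow> (nat \<Rightarrow> int) \<Rightarrow> int" where
  "C_sum p c = (\<Sum>j<p. 3 - c j)"

definition u_val :: "nat \<Rightarrow> (nat \<Rightarrow> int) \<Rightarrow> nat \<Rightarrow> real" where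
  "u_val L b h = reg_value (periodic L (reversed_block L b h))"

definition U_val ::
  "real \<Rightarrow> nat \<Rightarrow> (nat \<Rightarrow> int) \<Rightarrow> nat \<Rightarrow> (nat \<Rightarrow> int) \<Rightarrow> nat \<Rightarrow> real" where
  "U_val z p a L b h =
     of_int (A_sum p a + (-1) ^ (p + 1) * (\<Sum>k = 1..h. (-1) ^ (k - 1) * b k)) +
     (if even (p + h) then z + 1 / u_val L b h - 3 else z - 1 / u_val L b h)"

definition v_val :: "nat \<Rightarrow> (nat \<Rightarrow> int) \<Rightarrow> nat \<Rightarrow> real" where
  "v_val m d i = neg_value (periodic m (reversed_block m d i))"

definition V_val ::
  "real \<Rightarrow> nat \<Rightarrow> (nat \<Rightarrow> int) \<Rightarrow> nat \<Rightarrow> (nat \<Rightarrow> int) \<Rightarrow> nat \<Rightarrow> real" where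
  "V_val z p c m d i =
     of_int (C_sum p c + (\<Sum>j = 1..i. 3 - d j)) + z - 1 / v_val m d i - 3"

end

theory Submission imports Defs begin

text \<open>Modulo 1, the numbers \<open>U\<^sub>h\<close> and \<open>V\<^sub>i\<close> are \<open>z \<plusminus> 1/u\<^sub>h\<close> and \<open>z - 1/v\<^sub>i\<close>. A coincidence of
  two of them with equal signs forces \<open>u\<^sub>h = u\<^sub>k\<close> (resp. \<open>v\<^sub>i = v\<^sub>k\<close>), so by uniqueness of the
  expansions the reversed period agrees with a shift of itself, against the minimality of the
  period. A coincidence with opposite signs forces \<open>1/u\<^sub>h + 1/u\<^sub>k = 1\<close>; then one expansion is
  \<open>1, x - 1, \<dots>\<close> and the other is \<open>x, \<dots>\<close> with the same continuation, and extending this common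
  continuation backwards by periodicity gives \<open>x - 1 = x\<close>.\<close>

section \<open>Infinite regular continued fractions\<close>

lemma reg_conv_ge_1:
  assumes "\<And>k. s k \<ge> 1"
  shows "reg_conv s n \<ge> 1"
  using assms
proof (induction n arbitrary: s)
  case 0
  have "s 0 \<ge> 1" by (rule 0)
  then show ?case by simp
next
  case (Suc n)
  have "reg_conv (\<lambda>k. s (Suc k)) n \<ge> 1" by (rule Suc.IH) (rule Suc.prems)
  then have "1 / reg_conv (\<lambda>k. s (Suc k)) n \<ge> 0" by simp
  moreover have "real_of_int (s 0) \<ge> 1" using Suc.prems[of 0] by simp
  ultimately show ?case unfolding reg_conv.simps by linarith
qed

text \<open>Since \<open>1 / (e + 1 / t) = t / (e * t + 1)\<close>, the difference is
  \<open>x - y\<close> over a product of two factors that are each at least 2. Two steps are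
  combined because a single inversion need not contract near 1.\<close>

lemma two_step_contraction:
  fixes x y e :: real
  assumes "x \<ge> 1" "y \<ge> 1" "e \<ge> 1"
  shows "\<bar>1 / (e + 1 / x) - 1 / (e + 1 / y)\<bar> \<le> \<bar>x - y\<bar> / 4"
proof -
  have ex: "e * x \<ge> 1" "e * y \<ge> 1"
    using mult_mono[OF assms(3) assms(1)] mult_mono[OF assms(3) assms(2)] assms by simp_all
  have "1 / (e + 1 / t) = t / (e * t + 1)" if "t \<ge> 1" for t
  proof -
    have "e + 1 / t = (e * t + 1) / t" using that by (simp add: add_divide_distrib)
    then show ?thesis by simp
  qed
  then have "1 / (e + 1 / x) = x / (e * x + 1)" "1 / (e + 1 / y) = y / (e * y + 1)"
    using assms by blast+
  moreover have "x / (e * x + 1) - y / (e * y + 1) = (x - y) / ((e * x + 1) * (e * y + 1))"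
    using ex by (subst diff_frac_eq) (auto simp: algebra_simps)
  ultimately have "1 / (e + 1 / x) - 1 / (e + 1 / y) = (x - y) / ((e * x + 1) * (e * y + 1))"
    by simp
  then have "\<bar>1 / (e + 1 / x) - 1 / (e + 1 / y)\<bar> = \<bar>x - y\<bar> / ((e * x + 1) * (e * y + 1))"
    using ex by (simp add: abs_mult)
  also have "\<dots> \<le> \<bar>x - y\<bar> / 4"
  proof (rule divide_left_mono)
    show "4 \<le> (e * x + 1) * (e * y + 1)"
      using mult_mono[of 2 "e * x + 1" 2 "e * y + 1"] ex by simp
  qed (use ex in simp_all)
  finally show ?thesis .
qed

text \<open>Each contraction uses up two partial quotients, hence the two-step induction and the
  exponent \<open>n div 2\<close>. The bound is uniform in \<open>k\<close>, which gives the Cauchy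
  property.\<close>

lemma reg_conv_dist:
  assumes "\<And>k. s k \<ge> 1"
  shows "\<bar>reg_conv s n - reg_conv s (n + k)\<bar> \<le> (1 / 4) ^ (n div 2)"
  using assms
proof (induction n arbitrary: s rule: induct_nat_012)
  case 0
  show ?case
  proof (cases k)
    case (Suc j)
    then show ?thesis using reg_conv_ge_1[of "\<lambda>k. s (Suc k)" j] 0 by simp
  qed simp
next
  case 1
  show ?case
  proof (cases k)
    case (Suc j)
    define x where "x = reg_conv (\<lambda>k. s (Suc k)) 0"
    define y where "y = reg_conv (\<lambda>k. s (Suc k)) (Suc j)"
    have "x \<ge> 1" "y \<ge> 1" unfolding x_def y_def using 1 by (auto intro!: reg_conv_ge_1 simp del: reg_conv.simps)
    then have "0 < 1 / x" "1 / x \<le> 1" "0 < 1 / y" "1 / y \<le> 1" by simp_all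
    then have "\<bar>1 / x - 1 / y\<bar> \<le> 1" by linarith
    moreover have "reg_conv s (Suc 0) = s 0 + 1 / x" "reg_conv s (Suc 0 + k) = s 0 + 1 / y"
      by (auto simp: x_def y_def Suc)
    ultimately show ?thesis by simp
  qed simp
next
  case (ge2 n)
  define t where "t = (\<lambda>k. s (Suc (Suc k)))"
  have t: "\<And>k. t k \<ge> 1" using ge2.prems by (simp add: t_def)
  have "real_of_int (s (Suc 0)) \<ge> 1" using ge2.prems[of "Suc 0"] by simp
  from two_step_contraction[OF reg_conv_ge_1[of t n, OF t] reg_conv_ge_1[of t "n + k", OF t] this]
  have "\<bar>reg_conv s (Suc (Suc n)) - reg_conv s (Suc (Suc n) + k)\<bar>
      \<le> \<bar>reg_conv t n - reg_conv t (n + k)\<bar> / 4"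
    by (simp add: t_def)
  also have "\<dots> \<le> (1 / 4) ^ (n div 2) / 4" using ge2.IH(1)[of t, OF t] by simp
  finally show ?case by simp
qed

lemma reg_conv_tendsto:
  assumes s: "\<And>k. s k \<ge> 1"
  shows "reg_conv s \<longlonglongrightarrow> reg_value s"
proof -
  have "Cauchy (reg_conv s)"
  proof (rule metric_CauchyI)
    fix e :: real assume "e > 0"
    then obtain N where N: "(1 / 4) ^ N < e / 2" using real_arch_pow_inv[of "e / 2" "1 / 4"] by auto
    have "dist (reg_conv s m) (reg_conv s (2 * N)) < e / 2" if "m \<ge> 2 * N" for m
    proof -
      have "\<bar>reg_conv s (2 * N) - reg_conv s m\<bar> \<le> (1 / 4) ^ N"
        using reg_conv_dist[of s "2 * N" "m - 2 * N", OF s] that by simp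
      then show ?thesis using N by (simp add: dist_real_def abs_minus_commute)
    qed
    then show "\<exists>M. \<forall>m\<ge>M. \<forall>n\<ge>M. dist (reg_conv s m) (reg_conv s n) < e"
      by (meson dist_triangle_half_l)
  qed
  then show ?thesis
    unfolding reg_value_def by (simp add: Cauchy_convergent convergent_LIMSEQ_iff[symmetric])
qed

lemma reg_value_ge_1:
  assumes s: "\<And>k. s k \<ge> 1"
  shows "reg_value s \<ge> 1"
proof (rule LIMSEQ_le_const[OF reg_conv_tendsto[of s, OF s]])
  show "\<exists>N. \<forall>n\<ge>N. 1 \<le> reg_conv s n" using reg_conv_ge_1[of s, OF s] by metis
qed

lemma reg_value_unfold:
  assumes s: "\<And>k. s k \<ge> 1"
  shows "reg_value s = of_int (s 0) + 1 / reg_value (\<lambda>k. s (Suc k))"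
proof -
  have "reg_value (\<lambda>k. s (Suc k)) \<noteq> 0" using reg_value_ge_1[of "\<lambda>k. s (Suc k)"] s by fastforce
  then have "(\<lambda>n. of_int (s 0) + 1 / reg_conv (\<lambda>k. s (Suc k)) n)
      \<longlonglongrightarrow> of_int (s 0) + 1 / reg_value (\<lambda>k. s (Suc k))"
    by (intro tendsto_intros reg_conv_tendsto s)
  then have "(\<lambda>n. reg_conv s (Suc n)) \<longlonglongrightarrow> of_int (s 0) + 1 / reg_value (\<lambda>k. s (Suc k))"
    by simp
  then show ?thesis
    using LIMSEQ_unique LIMSEQ_Suc[OF reg_conv_tendsto[of s, OF s]] by blast
qed

text \<open>The strict lower bound, applied to the tail, shows that the tail exceeds 1, which makes
  the upper bound strict too. So the value is never an integer and its floor is the first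
  digit.\<close>

lemma reg_value_bounds:
  assumes s: "\<And>k. s k \<ge> 1"
  shows "of_int (s 0) < reg_value s" "reg_value s < of_int (s 0) + 1"
proof -
  have gt: "of_int (t 0) < reg_value t" if "\<And>k. t k \<ge> 1" for t
    using reg_value_unfold[of t, OF that] reg_value_ge_1[of "\<lambda>k. t (Suc k)"] that by simp
  show "of_int (s 0) < reg_value s" by (rule gt[OF s])
  have "real_of_int (s (Suc 0)) \<ge> 1" using s[of "Suc 0"] by simp
  then have "reg_value (\<lambda>k. s (Suc k)) > 1" using gt[of "\<lambda>k. s (Suc k)"] s by fastforce
  then show "reg_value s < of_int (s 0) + 1" using reg_value_unfold[of s, OF s] by simp
qed

lemma reg_value_gt_1:
  assumes s: "\<And>k. s k \<ge> 1"
  shows "reg_value s > 1"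
proof -
  have "real_of_int (s 0) \<ge> 1" using s[of 0] by simp
  then show ?thesis using reg_value_bounds(1)[of s, OF s] by linarith
qed

lemma reg_value_inj:
  assumes s: "\<And>k. s k \<ge> 1" and t: "\<And>k. t k \<ge> 1" and eq: "reg_value s = reg_value t"
  shows "s n = t n"
  using assms
proof (induction n arbitrary: s t)
  case 0
  have "s 0 = \<lfloor>reg_value s\<rfloor>" "t 0 = \<lfloor>reg_value t\<rfloor>"
    using reg_value_bounds[of s, OF 0(1)] reg_value_bounds[of t, OF 0(2)] by linarith+
  then show ?case using 0 by simp
next
  case (Suc n)
  have "s 0 = \<lfloor>reg_value s\<rfloor>" "t 0 = \<lfloor>reg_value t\<rfloor>"
    using reg_value_bounds[of s, OF Suc.prems(1)] reg_value_bounds[of t, OF Suc.prems(2)]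
    by linarith+
  then have "s 0 = t 0" using Suc.prems(3) by simp
  then have "1 / reg_value (\<lambda>k. s (Suc k)) = 1 / reg_value (\<lambda>k. t (Suc k))"
    using reg_value_unfold[of s, OF Suc.prems(1)] reg_value_unfold[of t, OF Suc.prems(2)]
      Suc.prems(3) by linarith
  then have "reg_value (\<lambda>k. s (Suc k)) = reg_value (\<lambda>k. t (Suc k))" by simp
  with Suc.prems show ?case by (intro Suc.IH[of "\<lambda>k. s (Suc k)" "\<lambda>k. t (Suc k)"])
qed

text \<open>With \<open>x = reg_value t\<close> the equation reads
  \<open>reg_value s = 1 + 1 / (x - 1)\<close>. As \<open>x - 1 > 1\<close>, the expansion of
  \<open>s\<close> starts with 1 and continues with that of \<open>x - 1\<close>, which differs from
  that of \<open>x\<close> only in its first digit.\<close>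

lemma reg_value_complementary:
  assumes s: "\<And>k. s k \<ge> 1" and t: "\<And>k. t k \<ge> 1"
    and eq: "1 / reg_value s + 1 / reg_value t = 1" and gt: "reg_value t > 2"
  shows "s (Suc 0) = t 0 - 1" "s (Suc (Suc n)) = t (Suc n)"
proof -
  define x where "x = reg_value t"
  have x: "x > 2" using gt by (simp add: x_def)
  have rs: "reg_value s = 1 + 1 / (x - 1)"
    using eq x reg_value_gt_1[of s, OF s] unfolding x_def[symmetric]
    by (simp add: field_simps)
  have "1 / (x - 1) < 1" "1 / (x - 1) > 0" using x by simp_all
  then have "s 0 = 1" using reg_value_bounds[of s, OF s] rs by linarith
  then have "reg_value (\<lambda>k. s (Suc k)) = x - 1"
    using rs reg_value_unfold[of s, OF s] x by simp
  then have s1: "reg_value (\<lambda>k. s (Suc k)) = reg_value t - 1" by (simp add: x_def)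
  then show *: "s (Suc 0) = t 0 - 1"
    using reg_value_bounds[of "\<lambda>k. s (Suc k)", OF s] reg_value_bounds[of t, OF t] by linarith
  have "reg_value (\<lambda>k. s (Suc (Suc k))) = reg_value (\<lambda>k. t (Suc k))"
    using s1 * reg_value_unfold[of "\<lambda>k. s (Suc k)", OF s] reg_value_unfold[of t, OF t] by simp
  from reg_value_inj[OF s t this] show "s (Suc (Suc n)) = t (Suc n)" .
qed

section \<open>Infinite negative regular continued fractions\<close>

lemma neg_conv_gt_1:
  assumes "\<And>k. s k \<ge> 2"
  shows "neg_conv s n > 1"
  using assms
proof (induction n arbitrary: s)
  case 0
  have "s 0 \<ge> 2" by (rule 0)
  then show ?case by simp
next
  case (Suc n)
  have "neg_conv (\<lambda>k. s (Suc k)) n > 1" by (rule Suc.IH) (rule Suc.prems)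
  then have "1 / neg_conv (\<lambda>k. s (Suc k)) n < 1" by simp
  moreover have "real_of_int (s 0) \<ge> 2" using Suc.prems[of 0] by simp
  ultimately show ?case by simp
qed

text \<open>The map sending \<open>t\<close> to \<open>s 0 - 1 / t\<close> is increasing for
  positive \<open>t\<close>, so the inequality passes from the tail to the whole. Monotonicity and
  the lower bound 1 give convergence here, in place of a contraction.\<close>

lemma neg_conv_Suc_le:
  assumes "\<And>k. s k \<ge> 2"
  shows "neg_conv s (Suc n) \<le> neg_conv s n"
  using assms
proof (induction n arbitrary: s)
  case 0
  have "s (Suc 0) \<ge> 2" by (rule 0)
  then show ?case by simp
next
  case (Suc n)
  let ?t = "\<lambda>k. s (Suc k)"
  have "neg_conv ?t (Suc n) \<le> neg_conv ?t n" by (rule Suc.IH) (rule Suc.prems)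
  moreover have "neg_conv ?t (Suc n) > 1" using Suc.prems by (intro neg_conv_gt_1)
  ultimately have "1 / neg_conv ?t n \<le> 1 / neg_conv ?t (Suc n)" by (intro divide_left_mono) auto
  then show ?case by (subst (1 2) neg_conv.simps(2)) simp
qed

lemma neg_conv_tendsto:
  assumes s: "\<And>k. s k \<ge> 2"
  shows "neg_conv s \<longlonglongrightarrow> neg_value s"
proof -
  have "decseq (neg_conv s)" by (rule decseq_SucI) (rule neg_conv_Suc_le[of s, OF s])
  moreover have "1 \<le> neg_conv s n" for n using neg_conv_gt_1[of s n, OF s] by simp
  ultimately obtain x where "neg_conv s \<longlonglongrightarrow> x"
    using decseq_convergent[of "neg_conv s" 1] by metis
  then show ?thesis unfolding neg_value_def by (simp add: limI)
qed

lemma neg_value_ge_1: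
  assumes s: "\<And>k. s k \<ge> 2"
  shows "neg_value s \<ge> 1"
proof (rule LIMSEQ_le_const[OF neg_conv_tendsto[of s, OF s]])
  show "\<exists>N. \<forall>n\<ge>N. 1 \<le> neg_conv s n" using neg_conv_gt_1[of s, OF s] less_imp_le by metis
qed

lemma neg_value_unfold:
  assumes s: "\<And>k. s k \<ge> 2"
  shows "neg_value s = of_int (s 0) - 1 / neg_value (\<lambda>k. s (Suc k))"
proof -
  have "neg_value (\<lambda>k. s (Suc k)) \<noteq> 0" using neg_value_ge_1[of "\<lambda>k. s (Suc k)"] s by fastforce
  then have "(\<lambda>n. of_int (s 0) - 1 / neg_conv (\<lambda>k. s (Suc k)) n)
      \<longlonglongrightarrow> of_int (s 0) - 1 / neg_value (\<lambda>k. s (Suc k))"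
    by (intro tendsto_intros neg_conv_tendsto s)
  then have "(\<lambda>n. neg_conv s (Suc n)) \<longlonglongrightarrow> of_int (s 0) - 1 / neg_value (\<lambda>k. s (Suc k))"
    by simp
  then show ?thesis
    using LIMSEQ_unique LIMSEQ_Suc[OF neg_conv_tendsto[of s, OF s]] by blast
qed

text \<open>From \<open>s 0 \<ge> 2\<close> and a tail of value at least 1, the value 1 leaves only
  \<open>s 0 = 2\<close> and a tail of value 1 again. This isolates the constant sequence 2, whose
  first digit is not the ceiling of its value.\<close>

lemma neg_value_eq_1:
  assumes "\<And>k. s k \<ge> 2" "neg_value s = 1"
  shows "s n = 2"
  using assms
proof (induction n arbitrary: s)
  case 0
  have "1 / neg_value (\<lambda>k. s (Suc k)) \<le> 1" using neg_value_ge_1[of "\<lambda>k. s (Suc k)"] 0 by simp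
  then show ?case using 0 neg_value_unfold[of s, OF 0(1)] 0(1)[of 0] by linarith
next
  case (Suc n)
  have "neg_value (\<lambda>k. s (Suc k)) \<ge> 1" using neg_value_ge_1[of "\<lambda>k. s (Suc k)"] Suc.prems by simp
  moreover from this have le: "1 / neg_value (\<lambda>k. s (Suc k)) \<le> 1" by simp
  then have "1 / neg_value (\<lambda>k. s (Suc k)) = 1"
    using Suc.prems(2) neg_value_unfold[of s, OF Suc.prems(1)] Suc.prems(1)[of 0] by linarith
  ultimately have "neg_value (\<lambda>k. s (Suc k)) = 1" by (simp add: divide_eq_eq)
  then show ?case using Suc.prems(1) by (intro Suc.IH[of "\<lambda>k. s (Suc k)"])
qed

lemma neg_value_ceiling:
  assumes s: "\<And>k. s k \<ge> 2" and ne: "s (Suc j) \<noteq> 2"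
  shows "s 0 = \<lceil>neg_value s\<rceil>"
proof -
  have "neg_value (\<lambda>k. s (Suc k)) \<ge> 1" "neg_value (\<lambda>k. s (Suc k)) \<noteq> 1"
    using neg_value_ge_1[of "\<lambda>k. s (Suc k)"] neg_value_eq_1[of "\<lambda>k. s (Suc k)" j] s ne by auto
  then have "1 / neg_value (\<lambda>k. s (Suc k)) < 1" "1 / neg_value (\<lambda>k. s (Suc k)) > 0" by auto
  then show ?thesis using neg_value_unfold[of s, OF s] by linarith
qed

text \<open>Digits are recovered one by one as ceilings. Having entries other than 2 arbitrarily far
  out is a condition inherited by tails, so the ceiling is the digit at every stage.\<close>

lemma neg_value_inj:
  assumes "\<And>k. s k \<ge> 2" "\<And>k. t k \<ge> 2"
    and "\<And>k. \<exists>j>k. s j \<noteq> 2" "\<And>k. \<exists>j>k. t j \<noteq> 2"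
    and "neg_value s = neg_value t"
  shows "s n = t n"
  using assms
proof (induction n arbitrary: s t)
  case 0
  obtain i j where "s (Suc i) \<noteq> 2" "t (Suc j) \<noteq> 2"
    using 0(3)[of 0] 0(4)[of 0] by (metis gr0_implies_Suc)
  then show ?case using neg_value_ceiling[of s i, OF 0(1)] neg_value_ceiling[of t j, OF 0(2)] 0(5) by simp
next
  case (Suc n)
  obtain i j where "s (Suc i) \<noteq> 2" "t (Suc j) \<noteq> 2"
    using Suc.prems(3)[of 0] Suc.prems(4)[of 0] by (metis gr0_implies_Suc)
  then have "s 0 = t 0"
    using neg_value_ceiling[of s i, OF Suc.prems(1)] neg_value_ceiling[of t j, OF Suc.prems(2)]
      Suc.prems(5) by simp
  then have "1 / neg_value (\<lambda>k. s (Suc k)) = 1 / neg_value (\<lambda>k. t (Suc k))"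
    using neg_value_unfold[of s, OF Suc.prems(1)] neg_value_unfold[of t, OF Suc.prems(2)]
      Suc.prems(5) by linarith
  then have "neg_value (\<lambda>k. s (Suc k)) = neg_value (\<lambda>k. t (Suc k))" by simp
  moreover have "\<exists>j>k. s (Suc j) \<noteq> 2" "\<exists>j>k. t (Suc j) \<noteq> 2" for k
    using Suc.prems(3)[of "Suc k"] Suc.prems(4)[of "Suc k"] by (metis Suc_lessE)+
  ultimately show ?case
    using Suc.prems(1,2) by (intro Suc.IH[of "\<lambda>k. s (Suc k)" "\<lambda>k. t (Suc k)"])
qed

section \<open>Digits of irrational numbers\<close>

lemma reg_quot_irrational:
  assumes "z \<notin> \<rat>"
  shows "reg_quot z j \<notin> \<rat>"
proof (induction j)
  case (Suc j)
  show ?case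
  proof
    assume "reg_quot z (Suc j) \<in> \<rat>"
    then have "1 / reg_quot z (Suc j) + of_int \<lfloor>reg_quot z j\<rfloor> \<in> \<rat>"
      by (intro Rats_add Rats_divide) auto
    then show False using Suc by simp
  qed
qed (simp add: assms)

lemma neg_quot_irrational:
  assumes "z \<notin> \<rat>"
  shows "neg_quot z j \<notin> \<rat>"
proof (induction j)
  case (Suc j)
  show ?case
  proof
    assume "neg_quot z (Suc j) \<in> \<rat>"
    then have "of_int \<lceil>neg_quot z j\<rceil> - 1 / neg_quot z (Suc j) \<in> \<rat>"
      by (intro Rats_diff Rats_divide) auto
    then show False using Suc by simp
  qed
qed (simp add: assms)

text \<open>Irrationality keeps the fractional part strictly between 0 and 1, so every later
  quotient exceeds 1. The index is \<open>Suc j\<close> because the initial digit may be any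
  integer.\<close>

lemma reg_digit_Suc_ge_1:
  assumes "z \<notin> \<rat>"
  shows "reg_digit z (Suc j) \<ge> 1"
proof -
  have "reg_quot z j \<noteq> of_int \<lfloor>reg_quot z j\<rfloor>"
    using reg_quot_irrational[OF assms, of j] by (metis Rats_of_int)
  then have "0 < reg_quot z j - of_int \<lfloor>reg_quot z j\<rfloor>" "reg_quot z j - of_int \<lfloor>reg_quot z j\<rfloor> < 1"
    by linarith+
  then have "reg_quot z (Suc j) > 1" by simp
  then show ?thesis unfolding reg_digit_def by linarith
qed

lemma neg_digit_Suc_ge_2:
  assumes "z \<notin> \<rat>"
  shows "neg_digit z (Suc j) \<ge> 2"
proof -
  have "neg_quot z j \<noteq> of_int \<lceil>neg_quot z j\<rceil>"
    using neg_quot_irrational[OF assms, of j] by (metis Rats_of_int)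
  then have "0 < of_int \<lceil>neg_quot z j\<rceil> - neg_quot z j" "of_int \<lceil>neg_quot z j\<rceil> - neg_quot z j < 1"
    by linarith+
  then have "neg_quot z (Suc j) > 1" by simp
  then show ?thesis unfolding neg_digit_def by linarith
qed

section \<open>Two-sided periodic extension of a block\<close>

text \<open>Indexing by all integers turns the reversed block into reading leftwards from
  \<open>h\<close>, without wrap-around cases. The shifts by 1 place \<open>y j\<close> at index
  \<open>j\<close>, as blocks start at 1.\<close>

definition two_sided :: "nat \<Rightarrow> (nat \<Rightarrow> int) \<Rightarrow> int \<Rightarrow> int" where
  "two_sided l y n = y (nat ((n - 1) mod int l) + 1)"

lemma two_sided_cong:
  assumes "int l dvd n - n'"
  shows "two_sided l y n = two_sided l y n'"
proof -
  have "(n - 1) mod int l = (n' - 1) mod int l" using assms by (simp add: mod_eq_dvd_iff)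
  then show ?thesis by (simp add: two_sided_def)
qed

lemma two_sided_eq:
  assumes "1 \<le> j" "j \<le> l"
  shows "two_sided l y (int j) = y j"
proof -
  have "nat ((int j - 1) mod int l) = j - 1"
    using assms by (simp add: of_nat_diff)
  then show ?thesis using assms by (simp add: two_sided_def)
qed

text \<open>Both branches of \<open>reversed_block\<close> pick an index congruent to
  \<open>h - k\<close> modulo \<open>n\<close>, hence modulo \<open>l\<close>. Allowing
  \<open>n\<close> to be a multiple of \<open>l\<close> covers the doubled period.\<close>

lemma periodic_reversed_block:
  assumes "h \<in> {1..n}" "l dvd n" "\<And>j. j \<in> {1..n} \<Longrightarrow> y j = two_sided l y (int j)"
  shows "periodic n (reversed_block n y h) k = two_sided l y (int h - int k)"
proof -
  let ?i = "k mod n + 1"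
  have n: "n > 0" "?i \<le> n" "h \<le> n" using assms(1) by (auto simp: Suc_le_eq)
  have d: "int l dvd int k - int (k mod n)" "int l dvd int n"
    using assms(2) by (auto simp: zmod_int minus_mod_eq_mult_div)
  show ?thesis
  proof (cases "?i \<le> h")
    case True
    have "h + 1 - ?i \<in> {1..n}" using n True unfolding atLeastAtMost_iff by arith
    then have "periodic n (reversed_block n y h) k = two_sided l y (int (h + 1 - ?i))"
      using assms(3)[of "h + 1 - ?i"] True by (simp add: periodic_def reversed_block_def)
    also have "\<dots> = two_sided l y (int h - int k)"
      using True d by (intro two_sided_cong) (simp add: of_nat_diff algebra_simps)
    finally show ?thesis .
  next
    case False
    have "n + h + 1 - ?i \<in> {1..n}" using n False unfolding atLeastAtMost_iff by arith
    then have "periodic n (reversed_block n y h) k = two_sided l y (int (n + h + 1 - ?i))"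
      using assms(3)[of "n + h + 1 - ?i"] False by (simp add: periodic_def reversed_block_def)
    also have "\<dots> = two_sided l y (int h - int k)"
    proof (rule two_sided_cong)
      have "int (n + h + 1 - ?i) - (int h - int k) = int n + (int k - int (k mod n))"
        using n by (simp add: of_nat_diff algebra_simps)
      then show "int l dvd int (n + h + 1 - ?i) - (int h - int k)" using d by simp
    qed
    finally show ?thesis .
  qed
qed

text \<open>Agreement to the left of \<open>i\<close> and \<open>j\<close> spreads to the right,
  since by periodicity every index has a representative arbitrarily far to the left.\<close>

lemma two_sided_extend:
  assumes "l > 0" and eq: "\<And>k. two_sided l y (i - int k) = two_sided l y (j - int k)"
  shows "two_sided l y (n + i) = two_sided l y (n + j)"
proof -
  \<comment> \<open>A nonnegative representative of \<open>- n\<close> modulo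
    \<open>l\<close>.\<close>
  define k where "k = nat (int l * \<bar>n\<bar> - n)"
  have "\<bar>n\<bar> \<le> int l * \<bar>n\<bar>" using assms(1) by (simp add: mult_le_cancel_right1)
  then have k: "int k = int l * \<bar>n\<bar> - n" unfolding k_def by (intro nat_0_le) linarith
  have "two_sided l y (n + i) = two_sided l y (i - int k)" by (rule two_sided_cong) (simp add: k)
  also have "\<dots> = two_sided l y (j - int k)" by (rule eq)
  also have "\<dots> = two_sided l y (n + j)" by (rule two_sided_cong) (simp add: k)
  finally show ?thesis .
qed

lemma has_period_digit:
  assumes "has_period s p x l y"
  shows "s (p + k) = two_sided l y (int k + 1)"
proof -
  have "nat (int k mod int l) = k mod l" by (metis nat_int of_nat_mod)
  then show ?thesis using assms by (simp add: has_period_def preperiodic_def two_sided_def)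
qed

lemma two_sided_ge:
  assumes per: "has_period s p x l y" and ge: "\<And>j. s (Suc j) \<ge> c"
  shows "two_sided l y n \<ge> c"
proof -
  have l: "l > 0" using per by (simp add: has_period_def)
  \<comment> \<open>The extra \<open>l\<close> keeps \<open>p + k\<close> positive even if
    \<open>p = 0\<close>, because digit 0 is not covered by the bound.\<close>
  define k where "k = nat ((n - 1) mod int l) + l"
  have k: "int k = (n - 1) mod int l + int l" using l by (simp add: k_def)
  have "int l dvd n - (int k + 1)"
    unfolding k by (metis add_diff_eq add_diff_eq diff_diff_eq2 dvd_minus_mod dvd_diff dvd_refl diff_add_eq_diff_diff_swap add.commute)
  then have "two_sided l y n = s (p + k)" unfolding has_period_digit[OF per] by (rule two_sided_cong)
  moreover have "p + k = Suc (p + k - 1)" using l by (simp add: k_def)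
  ultimately show ?thesis using ge[of "p + k - 1"] by simp
qed

text \<open>The remainder of \<open>\<delta>\<close> modulo \<open>l\<close> is again a shift that
  preserves the sequence. If it were nonzero, it would be a period of the digits smaller than
  \<open>l\<close>.\<close>

lemma minimal_period_dvd:
  assumes mp: "has_minimal_period s p x l y"
    and shift: "\<And>n. two_sided l y (n + \<delta>) = two_sided l y n"
  shows "int l dvd \<delta>"
proof (rule ccontr)
  assume "\<not> int l dvd \<delta>"
  have per: "has_period s p x l y" and l: "l > 0"
    using mp by (auto simp: has_minimal_period_def has_period_def)
  define r where "r = nat (\<delta> mod int l)"
  have r: "int r = \<delta> mod int l" using l by (simp add: r_def)
  have "r > 0" using \<open>\<not> int l dvd \<delta>\<close> l r by (metis dvd_eq_mod_eq_0 gr0I of_nat_0)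
  have "r < l" using l r by (metis of_nat_less_iff pos_mod_bound of_nat_0_less_iff)
  have shr: "two_sided l y (n + int r) = two_sided l y n" for n
  proof -
    have "two_sided l y (n + int r) = two_sided l y (n + \<delta>)"
      by (rule two_sided_cong) (simp add: r mod_eq_dvd_iff[symmetric])
    then show ?thesis using shift by simp
  qed
  have shrm: "two_sided l y (n + int r * int q) = two_sided l y n" for n and q :: nat
  proof (induction q)
    case (Suc q)
    have "n + int r * int (Suc q) = (n + int r * int q) + int r" by (simp add: algebra_simps)
    then show ?case using Suc shr by metis
  qed simp
  \<comment> \<open>The preperiod is kept, and the new block consists of the entries at indices 1 to
    \<open>r\<close>.\<close>
  have "has_period s p x r (\<lambda>j. two_sided l y (int j))"
    unfolding has_period_def preperiodic_def
  proof (intro conjI allI)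
    fix k
    show "s k = (if k < p then x k else two_sided l y (int ((k - p) mod r + 1)))"
    proof (cases "k < p")
      case True
      then show ?thesis using per by (simp add: has_period_def preperiodic_def)
    next
      case False
      let ?i = "k - p"
      have "int ?i + 1 = int (?i mod r + 1) + int r * int (?i div r)"
        by (metis add.commute add.left_commute mult_div_mod_eq of_nat_1 of_nat_add of_nat_mult)
      then have "two_sided l y (int ?i + 1) = two_sided l y (int (?i mod r + 1))"
        using shrm[of "int (?i mod r + 1)" "?i div r"] by metis
      moreover have "s k = two_sided l y (int ?i + 1)"
        using has_period_digit[OF per, of ?i] False by simp
      ultimately show ?thesis using False by simp
    qed
  qed (rule \<open>r > 0\<close>)
  then have "l \<le> r" using mp unfolding has_minimal_period_def by blast
  then show False using \<open>r < l\<close> by simp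
qed

text \<open>Two points of the interval from 0 (excluded) to 1 (included) differ by less than 1.
  Including 1 suits the negative expansions, where only \<open>1 / w n \<le> 1\<close> is
  established.\<close>

lemma Ints_eq_if_unit_bounds:
  fixes x y :: real
  assumes "x - y = of_int k" "0 < x" "x \<le> 1" "0 < y" "y \<le> 1"
  shows "x = y"
proof -
  have "real_of_int k < 1" "- 1 < real_of_int k" using assms by linarith+
  then have "real_of_int k = 0" by simp
  then show ?thesis using assms(1) by linarith
qed

section \<open>Distinctness of the cluster points\<close>

text \<open>Reciprocals with sum 1 belong to two values equal to 2, which is impossible for a
  non-integer, or to one value above 2. In the latter case the complementary expansions agree to the
  left of certain indices, and periodicity extends this to entries that differ by 1.\<close>

lemma reg_value_reversed_not_complementary:
  assumes per: "has_period s p x l y" and ge: "\<And>n. two_sided l y n \<ge> 1"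
  defines "w \<equiv> \<lambda>h. reg_value (\<lambda>k. two_sided l y (h - int k))"
  shows "1 / w i + 1 / w j \<noteq> 1"
proof
  assume eq: "1 / w i + 1 / w j = 1"
  have l: "l > 0" using per by (simp add: has_period_def)
  have no: False if eq: "1 / w i + 1 / w j = 1" and gt: "w j > 2" for i j
  proof -
    note c = reg_value_complementary[of "\<lambda>k. two_sided l y (i - int k)"
        "\<lambda>k. two_sided l y (j - int k)", OF ge ge eq[unfolded w_def] gt[unfolded w_def]]
    have "two_sided l y ((i - 2) - int k) = two_sided l y ((j - 1) - int k)" for k
      using c(2)[of k] by (simp add: algebra_simps)
    \<comment> \<open>One place further to the right are the indices \<open>i - 1\<close> and
      \<open>j\<close>, whose entries differ by 1 according to \<open>c(1)\<close>.\<close>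
    from two_sided_extend[OF l this, of 1] show False using c(1) by simp
  qed
  have pos: "w i > 1" "w j > 1" unfolding w_def using ge by (auto intro: reg_value_gt_1)
  have "w j \<noteq> 2"
  proof
    assume "w j = 2"
    then have "real_of_int (two_sided l y j) < 2" "1 < real_of_int (two_sided l y j)"
      using reg_value_bounds[of "\<lambda>k. two_sided l y (j - int k)", OF ge] by (simp_all add: w_def)
    then show False by simp
  qed
  moreover have "w i > 2" if "w j < 2"
  proof -
    have "1 / w j > 1 / 2" using that pos by (simp add: field_simps)
    then have "1 / w i < 1 / 2" using eq by linarith
    then show ?thesis using pos by (simp add: field_simps)
  qed
  ultimately show False using no[of i j] no[of j i] eq by (simp add: add.commute) linarith
qed

text \<open>Modulo 1 only the signed reciprocals of \<open>u_val\<close> matter. As \<open>L\<close>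
  may be twice the minimal period, the parity of \<open>h - h'\<close> must also be recovered; it
  comes from the signs.\<close>

lemma inj_on_U_val:
  assumes z: "z \<notin> \<rat>" and mp: "has_minimal_period (reg_digit z) p a l b"
    and L: "L = (if even l then l else 2 * l)"
    and b: "\<forall>j\<in>{1..l}. b (l + j) = b j"
  shows "inj_on (U_val z p a L b) {1..L}"
proof (rule inj_onI)
  fix h h' assume h: "h \<in> {1..L}" and h': "h' \<in> {1..L}"
    and eq: "U_val z p a L b h = U_val z p a L b h'"
  have per: "has_period (reg_digit z) p a l b" and l: "l > 0"
    using mp by (auto simp: has_minimal_period_def has_period_def)
  have ge: "two_sided l b n \<ge> 1" for n using two_sided_ge[OF per reg_digit_Suc_ge_1[OF z]] .
  have lL: "l dvd L" by (simp add: L)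
  have bL: "b j = two_sided l b (int j)" if "j \<in> {1..L}" for j
  proof (cases "j \<le> l")
    case True
    then show ?thesis using that two_sided_eq[of j l b] by simp
  next
    case False
    then have j: "j - l \<in> {1..l}" "j = l + (j - l)" using that L by (auto split: if_splits)
    have "b j = b (j - l)" using b j by metis
    also have "\<dots> = two_sided l b (int (j - l))" using j two_sided_eq[of "j - l" l b] by simp
    also have "\<dots> = two_sided l b (int j)" using False by (intro two_sided_cong) (simp add: of_nat_diff)
    finally show ?thesis .
  qed
  define w where "w = (\<lambda>h. reg_value (\<lambda>k. two_sided l b (h - int k)))"
  have u: "u_val L b h = w (int h)" if "h \<in> {1..L}" for h
  proof -
    have "periodic L (reversed_block L b h) = (\<lambda>k. two_sided l b (int h - int k))"
      using periodic_reversed_block[OF that lL bL] by blast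
    then show ?thesis by (simp add: u_val_def w_def)
  qed
  have w1: "w n > 1" for n unfolding w_def using ge by (rule reg_value_gt_1)
  have bd: "0 < 1 / w n" "1 / w n < 1" for n using w1[of n] by auto
  define I where "I = (\<lambda>h. A_sum p a + (-1) ^ (p + 1) * (\<Sum>k = 1..h. (-1) ^ (k - 1) * b k))"
  have U: "U_val z p a L b h = of_int (I h)
      + (if even (p + h) then z + 1 / w (int h) - 3 else z - 1 / w (int h))" if "h \<in> {1..L}" for h
    unfolding U_val_def I_def u[OF that] ..
  \<comment> \<open>Both summands lie strictly between 0 and 1, so 1 is the only candidate.\<close>
  have sum_ne: "1 / w i + 1 / w j \<noteq> of_int k" for i j k
  proof
    assume *: "1 / w i + 1 / w j = of_int k"
    then have "k = 1" using bd[of i] bd[of j] by linarith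
    then show False
      using * reg_value_reversed_not_complementary[OF per ge, of i j] by (simp add: w_def)
  qed
  \<comment> \<open>Opposite signs would make a sum of two reciprocals an integer.\<close>
  have parity: "even (p + h) \<longleftrightarrow> even (p + h')"
  proof (rule ccontr)
    assume "\<not> ?thesis"
    then consider "even (p + h)" "odd (p + h')" | "odd (p + h)" "even (p + h')" by blast
    then show False
    proof cases
      case 1
      then have "of_int (I h) + (z + 1 / w (int h) - 3) = of_int (I h') + (z - 1 / w (int h'))"
        using eq U[OF h] U[OF h'] by metis
      then have "1 / w (int h) + 1 / w (int h') = of_int (I h' - I h + 3)" by simp
      then show False using sum_ne by blast
    next
      case 2
      then have "of_int (I h) + (z - 1 / w (int h)) = of_int (I h') + (z + 1 / w (int h') - 3)"
        using eq U[OF h] U[OF h'] by metis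
      then have "1 / w (int h') + 1 / w (int h) = of_int (I h - I h' + 3)" by simp
      then show False using sum_ne by blast
    qed
  qed
  have "1 / w (int h) = 1 / w (int h')"
  proof (cases "even (p + h)")
    case True
    then have "1 / w (int h) - 1 / w (int h') = of_int (I h' - I h)"
      using eq U[OF h] U[OF h'] parity by simp
    then show ?thesis using bd less_imp_le by (blast intro: Ints_eq_if_unit_bounds)
  next
    case False
    then have "1 / w (int h) - 1 / w (int h') = of_int (I h - I h')"
      using eq U[OF h] U[OF h'] parity by simp
    then show ?thesis using bd less_imp_le by (blast intro: Ints_eq_if_unit_bounds)
  qed
  then have "w (int h) = w (int h')" by simp
  then have "two_sided l b (int h - int k) = two_sided l b (int h' - int k)" for k
    unfolding w_def using reg_value_inj[of "\<lambda>k. two_sided l b (int h - int k)"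
        "\<lambda>k. two_sided l b (int h' - int k)", OF ge ge] by blast
  \<comment> \<open>Equal leftward readings from \<open>h\<close> and \<open>h'\<close> make
    \<open>h - h'\<close> a shift that preserves the whole two-sided sequence.\<close>
  from two_sided_extend[OF l this]
  have "two_sided l b (n + (int h - int h')) = two_sided l b n" for n
    by (metis add.commute diff_add_cancel add_diff_eq diff_add_eq)
  then have "int l dvd int h - int h'" using minimal_period_dvd[OF mp] by blast
  \<comment> \<open>For odd \<open>l\<close> this supplies the coprime factor 2 of
    \<open>L = 2 * l\<close>.\<close>
  moreover have "int 2 dvd int h - int h'" using parity by auto
  ultimately have "int L dvd int h - int h'"
    by (cases "even l") (auto simp: L intro: divides_mult)
  moreover have "\<bar>int h - int h'\<bar> < int L" using h h' by auto
  ultimately show "h = h'" using zdvd_not_zless[of "\<bar>int h - int h'\<bar>" "int L"] by auto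
qed

text \<open>All signs agree, so equality modulo 1 already yields equal reciprocals of
  \<open>v_val\<close>. A block consisting only of 2 is treated separately, as uniqueness of digits
  relies on other entries.\<close>

lemma inj_on_V_val:
  assumes z: "z \<notin> \<rat>" and mp: "has_minimal_period (neg_digit z) p c m d"
  shows "inj_on (V_val z p c m d) {1..m}"
proof (rule inj_onI)
  fix h h' assume h: "h \<in> {1..m}" and h': "h' \<in> {1..m}"
    and eq: "V_val z p c m d h = V_val z p c m d h'"
  have per: "has_period (neg_digit z) p c m d" and m: "m > 0"
    using mp by (auto simp: has_minimal_period_def has_period_def)
  have ge: "two_sided m d n \<ge> 2" for n using two_sided_ge[OF per neg_digit_Suc_ge_2[OF z]] .
  have dm: "d j = two_sided m d (int j)" if "j \<in> {1..m}" for j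
    using that two_sided_eq[of j m d] by simp
  have bound: "\<bar>int h - int h'\<bar> < int m" using h h' by auto
  show "h = h'"
  proof (cases "\<exists>n. two_sided m d n \<noteq> 2")
    case False
    \<comment> \<open>A constant sequence is preserved by the shift 1, so \<open>m = 1\<close> and
      there is only one index.\<close>
    then have "int m dvd 1" using minimal_period_dvd[OF mp, of 1] by simp
    then show ?thesis using bound by simp
  next
    case True
    then obtain n where n: "two_sided m d n \<noteq> 2" ..
    have inf: "\<exists>j>k. two_sided m d (i - int j) \<noteq> 2" for i k
    proof -
      \<comment> \<open>Moving \<open>n\<close> left by \<open>t\<close> periods puts it more than
        \<open>k\<close> places to the left of \<open>i\<close>.\<close>
      define t where "t = \<bar>n - i\<bar> + int k + 1"
      define j where "j = nat (i - n + int m * t)"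
      have "t \<le> int m * t" using m mult_right_mono[of 1 "int m" t] by (simp add: t_def)
      moreover have "t > int k + (n - i)" by (simp add: t_def)
      ultimately have gt: "i - n + int m * t > int k" by linarith
      then have j: "int j = i - n + int m * t" unfolding j_def by (intro nat_0_le) linarith
      then have "two_sided m d (i - int j) = two_sided m d n" by (intro two_sided_cong) simp
      moreover have "j > k" using j gt by linarith
      ultimately show ?thesis using n by metis
    qed
    define w where "w = (\<lambda>h. neg_value (\<lambda>k. two_sided m d (h - int k)))"
    have v: "v_val m d h = w (int h)" if "h \<in> {1..m}" for h
    proof -
      have "periodic m (reversed_block m d h) = (\<lambda>k. two_sided m d (int h - int k))"
        using periodic_reversed_block[OF that dvd_refl dm] by blast
      then show ?thesis by (simp add: v_val_def w_def)
    qed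
    have w1: "w n \<ge> 1" for n unfolding w_def using ge by (rule neg_value_ge_1)
    have bd: "0 < 1 / w n" "1 / w n \<le> 1" for n using w1[of n] by auto
    define I where "I = (\<lambda>i. C_sum p c + (\<Sum>j = 1..i. 3 - d j))"
    have V: "V_val z p c m d h = of_int (I h) + z - 1 / w (int h) - 3" if "h \<in> {1..m}" for h
      unfolding V_val_def I_def v[OF that] ..
    have "1 / w (int h) - 1 / w (int h') = of_int (I h - I h')"
      using eq V[OF h] V[OF h'] by simp
    then have "1 / w (int h) = 1 / w (int h')" using bd by (blast intro: Ints_eq_if_unit_bounds)
    then have "w (int h) = w (int h')" by simp
    then have "two_sided m d (int h - int k) = two_sided m d (int h' - int k)" for k
      unfolding w_def using neg_value_inj[of "\<lambda>k. two_sided m d (int h - int k)"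
          "\<lambda>k. two_sided m d (int h' - int k)", OF ge ge inf inf] by blast
    from two_sided_extend[OF m this]
    have "two_sided m d (n + (int h - int h')) = two_sided m d n" for n
      by (metis add.commute diff_add_cancel add_diff_eq diff_add_eq)
    then have "int m dvd int h - int h'" using minimal_period_dvd[OF mp] by blast
    then show ?thesis
      using bound zdvd_not_zless[of "\<bar>int h - int h'\<bar>" "int m"] by auto
  qed
qed

theorem theorem3:
  fixes z :: real
    and p l L p' m :: nat
    and a b c d :: "nat \<Rightarrow> int"
  assumes "quadratic_irrational z"
    and "has_minimal_period (reg_digit z) p a l b"
    and "has_minimal_period (neg_digit z) p' c m d"
    and "L = (if even l then l else 2 * l)"
    and "\<forall>j\<in>{1..l}. b (l + j) = b j"
    and "B_sum p L b = 0"
  shows "inj_on (U_val z p a L b) {1..L} \<and> inj_on (V_val z p' c m d) {1..m}"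
proof -
  have "z \<notin> \<rat>" using assms(1) by (simp add: quadratic_irrational_def)
  then show ?thesis using inj_on_U_val inj_on_V_val assms(2-5) by blast
qed

end
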